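(* Let $T=\langle T_\alpha:\alpha\in\omega_1\rangle$ be a tower in $\mathcal P(\omega)$ which is strictly increasing, i.e. for all $\beta<\alpha<\omega_1$ the set $T_\beta\setminus T_\alpha$ is finite and $T_\alpha\setminus T_\beta$ is infinite. Then the gap cohomology group $\mathrm H^1(\mathcal D,F)$ of $T$ has cardinality at least $2^{\aleph_0}$.
   Context: Given a tower $T=\langle T_\alpha:\alpha\in\omega_1\rangle$ (so $T_\beta\setminus T_\alpha$ is finite for $\beta<\alpha$), let $\mathcal D$ be the family of all $D\subseteq\omega$ such that for some $\alpha\in\omega_1$, $D\supseteq T_\alpha$ and $D\setminus T_\alpha$ is finite. For $D\in\mathcal D$ let $F_D$ be the group (under pointwise addition) of finitely supported functions $D\to\mathbb Z/2$; for $D_1\supseteq D_2$ in $\mathcal D$ let the restriction map $F_{D_1}\to F_{D_2}$ be $f\mapsto f\restriction D_2$. The $n$-cochains are $$\mathrm C^n(\mathcal D,F)=\prod_{D_0\supseteq D_1\supseteq\dots\supseteq D_n,\ D_i\in\mathcal D}F_{D_n},$$ with coboundary $\delta:\mathrm C^n\to\mathrm C^{n+1}$ given by $$(\delta x)(D_0\supseteq\dots\supseteq D_{n+1})=\sum_{i=0}^n(-1)^i x(D_0\dots\widehat{D_i}\dots D_{n+1})+(-1)^{n+1}\,x(D_0\dots D_n)\restriction D_{n+1},$$ (where in the sum $\widehat{D_i}$ means $D_i$ is omitted). $\mathrm H^n(\mathcal D,F)$ is the $n$-th cohomology group of this complex; $\mathrm H^1(\mathcal D,F)$ is called the gap cohomology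 group of $T$. *)

theory Defs
  imports "HOL-Algebra.Algebra"
begin

unbundle cardinal_syntax

text \<open>
  \<open>omega1\<close> is the initial ordinal of cardinality \<open>\<aleph>\<^sub>1\<close>, as a reflexive well-order on its field:
  \<open>\<beta> \<le> \<alpha> < \<omega>\<^sub>1\<close> is \<open>(\<beta>, \<alpha>) \<in> omega1\<close>.
\<close>

definition omega1 :: "nat set rel"
  where "omega1 = cardSuc natLeq"

definition tower :: "(nat set \<Rightarrow> nat set) \<Rightarrow> bool"
  where "tower T \<longleftrightarrow> (\<forall>\<beta> \<alpha>. (\<beta>, \<alpha>) \<in> omega1 \<and> \<beta> \<noteq> \<alpha> \<longrightarrow> finite (T \<beta> - T \<alpha>))"

definition strictly_increasing_tower :: "(nat set \<Rightarrow> nat set) \<Rightarrow> bool"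
  where "strictly_increasing_tower T \<longleftrightarrow>
    tower T \<and> (\<forall>\<beta> \<alpha>. (\<beta>, \<alpha>) \<in> omega1 \<and> \<beta> \<noteq> \<alpha> \<longrightarrow> infinite (T \<alpha> - T \<beta>))"

definition tower_family :: "(nat set \<Rightarrow> nat set) \<Rightarrow> nat set set"
  where "tower_family T = {D. \<exists>\<alpha>\<in>Field omega1. T \<alpha> \<subseteq> D \<and> finite (D - T \<alpha>)}"

text \<open>
  Functions with domain \<open>D\<close> are functions on \<open>nat\<close> that are \<open>undefined\<close> outside \<open>D\<close>. All groups are
  written multiplicatively, as everywhere in \<^theory>\<open>HOL-Algebra.Group\<close>: \<open>\<otimes>\<close> is the pointwise addition
  modulo 2, \<open>\<one>\<close> is the zero function, and \<open>x [^] k\<close> is the multiple of \<open>x\<close> by the integer \<open>k\<close>.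
\<close>

definition finsupp_group :: "nat set \<Rightarrow> (nat \<Rightarrow> int) monoid"
  where "finsupp_group D = sum_group D (\<lambda>_. integer_mod_group 2)"

text \<open>\<open>D\<^sub>0 \<supseteq> \<dots> \<supseteq> D\<^sub>n\<close> is the list \<open>[D\<^sub>0, \<dots>, D\<^sub>n]\<close>.\<close>

definition desc_chains :: "nat set set \<Rightarrow> nat \<Rightarrow> nat set list set"
  where "desc_chains \<D> n = {s. length s = Suc n \<and> set s \<subseteq> \<D> \<and> sorted_wrt (\<supseteq>) s}"

definition omit :: "nat \<Rightarrow> 'a list \<Rightarrow> 'a list"
  where "omit i s = take i s @ drop (Suc i) s"

definition cochains :: "nat set set \<Rightarrow> nat \<Rightarrow> (nat set list \<Rightarrow> nat \<Rightarrow> int) monoid"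
  where "cochains \<D> n = product_group (desc_chains \<D> n) (\<lambda>s. finsupp_group (last s))"

definition coboundary ::
  "nat set set \<Rightarrow> nat \<Rightarrow> (nat set list \<Rightarrow> nat \<Rightarrow> int) \<Rightarrow> (nat set list \<Rightarrow> nat \<Rightarrow> int)"
  where "coboundary \<D> n x = (\<lambda>s\<in>desc_chains \<D> (Suc n).
    (\<Otimes>\<^bsub>finsupp_group (last s)\<^esub>i\<in>{0..n}. x (omit i s) [^]\<^bsub>finsupp_group (last s)\<^esub> ((-1) ^ i :: int))
      \<otimes>\<^bsub>finsupp_group (last s)\<^esub>
    restrict (x (butlast s)) (last s) [^]\<^bsub>finsupp_group (last s)\<^esub> ((-1) ^ Suc n :: int))"

definition cocycles :: "nat set set \<Rightarrow> nat \<Rightarrow> (nat set list \<Rightarrow> nat \<Rightarrow> int) set"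
  where "cocycles \<D> n = kernel (cochains \<D> n) (cochains \<D> (Suc n)) (coboundary \<D> n)"

definition coboundaries :: "nat set set \<Rightarrow> nat \<Rightarrow> (nat set list \<Rightarrow> nat \<Rightarrow> int) set"
  where "coboundaries \<D> n =
    (case n of 0 \<Rightarrow> {\<one>\<^bsub>cochains \<D> 0\<^esub>}
     | Suc m \<Rightarrow> coboundary \<D> m ` carrier (cochains \<D> m))"

definition cohomology_group :: "nat set set \<Rightarrow> nat \<Rightarrow> (nat set list \<Rightarrow> nat \<Rightarrow> int) set monoid"
  where "cohomology_group \<D> n = ((cochains \<D> n)\<lparr>carrier := cocycles \<D> n\<rparr>) Mod coboundaries \<D> n"

definition gap_cohomology_group :: "(nat set \<Rightarrow> nat set) \<Rightarrow> (nat set list \<Rightarrow> nat \<Rightarrow> int) set monoid"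
  where "gap_cohomology_group T = cohomology_group (tower_family T) 1"

end

theory Submission
  imports Defs
begin

text \<open>
  A family of sets \<open>a\<^sub>D \<subseteq> D\<close>, for \<open>D\<close> in the family of the tower, that is coherent modulo finite sets
  determines a 1-cocycle, the differences \<open>a\<^sub>E - a\<^sub>D\<restriction>E\<close>. Two such families \<open>a\<close>, \<open>b\<close> have the same
  class only if the sum \<open>a + b\<close> is trivial, i.e. almost equal on every \<open>D\<close> to the trace of a single
  set (\<open>cohomology_class_eqD\<close>). So it suffices to find continuum many coherent families with pairwise
  nontrivial sums.

  They all come from one construction. By recursion on \<open>\<alpha> < \<omega>\<^sub>1\<close>, in the way in which Hausdorff built
  his gap, one obtains a coherent sequence of colourings \<open>g\<^sub>\<alpha>\<close> of \<open>T\<^sub>\<alpha>\<close> by natural numbers such that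
  every colour \<open>i > 0\<close> forms an \<open>\<omega>\<^sub>1\<close>-gap with colour \<open>0\<close> (\<open>exists_entangled_family\<close>): for each \<open>n\<close>,
  all but finitely many \<open>\<beta> < \<alpha>\<close> have a point \<open>k \<ge> n\<close> with \<open>g\<^sub>\<beta> k = i\<close> and \<open>g\<^sub>\<alpha> k = 0\<close>.
  By a pigeonhole argument, the family \<open>h \<circ> g\<^sub>\<alpha>\<close> is then nontrivial for every \<open>h\<close> that is not constant
  (\<open>entangled_family_nontrivial\<close>).

  A set \<open>S\<close> of natural numbers yields the coherent family of the points whose colour is \<open>i + 1\<close> for
  some \<open>i \<in> S\<close>. The sum of the families of \<open>R\<close> and \<open>S\<close> is of the form \<open>h \<circ> g\<^sub>\<alpha>\<close>, where \<open>h\<close> vanishes at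
  \<open>0\<close> and is not constant unless \<open>R = S\<close>. Hence \<open>S\<close> is determined by its class.
\<close>

section \<open>Coherent families of colourings in Hausdorff's manner\<close>

text \<open>
  Hausdorff's condition, in one direction only: colour \<open>i > 0\<close> of the earlier function meets
  colour \<open>0\<close> of the later one. Because only colour \<open>0\<close> matters on the later side, turning further
  values of \<open>g\<close> into \<open>0\<close> can never destroy the condition. The single parameter \<open>n\<close> bounds the
  colours and pushes the witnesses to infinity at the same time.
\<close>

definition entangled ::
  "nat set \<Rightarrow> (nat \<Rightarrow> nat) \<Rightarrow> nat set \<Rightarrow> (nat \<Rightarrow> nat) \<Rightarrow> nat \<Rightarrow> bool"
  where "entangled A f B g n \<longleftrightarrow> (\<forall>i\<in>{1..n}. \<exists>k\<ge>n. k \<in> A \<inter> B \<and> f k = i \<and> g k = 0)"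

lemma entangled_antimono:
  assumes "entangled A f B g n" and "m \<le> n"
  shows "entangled A f B g m"
  using assms unfolding entangled_def by (meson atLeastAtMost_iff le_trans)

lemma entangled_weaken:
  assumes "entangled A f B g n" and "m \<le> n"
    and "\<And>k. k \<ge> n \<Longrightarrow> k \<in> A \<inter> B \<Longrightarrow> g k = 0 \<Longrightarrow> k \<in> C \<and> h k = 0"
  shows "entangled A f C h m"
  unfolding entangled_def
proof
  fix i assume "i \<in> {1..m}"
  then have "i \<in> {1..n}" using \<open>m \<le> n\<close> by auto
  then obtain k where "k \<ge> n" "k \<in> A \<inter> B" "f k = i" "g k = 0"
    using assms(1) unfolding entangled_def by blast
  then show "\<exists>k\<ge>m. k \<in> A \<inter> C \<and> f k = i \<and> h k = 0"
    using assms(2,3) by (intro exI[of _ k]) auto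
qed

text \<open>
  The index order has the properties of \<open>\<omega>\<^sub>1\<close> that the recursion needs. Linearity is asked only
  below a common bound, so that a type with elements outside the field of the order is admitted.
\<close>

locale strict_tower =
  fixes less :: "'i \<Rightarrow> 'i \<Rightarrow> bool" (infix \<open>\<triangleleft>\<close> 50)
    and T :: "'i \<Rightarrow> nat set"
  assumes wf_less: "wf {(\<beta>, \<alpha>). \<beta> \<triangleleft> \<alpha>}"
    and less_trans: "\<gamma> \<triangleleft> \<beta> \<Longrightarrow> \<beta> \<triangleleft> \<alpha> \<Longrightarrow> \<gamma> \<triangleleft> \<alpha>"
    and less_linear: "\<beta> \<triangleleft> \<alpha> \<Longrightarrow> \<gamma> \<triangleleft> \<alpha> \<Longrightarrow> \<beta> \<triangleleft> \<gamma> \<or> \<beta> = \<gamma> \<or> \<gamma> \<triangleleft> \<beta>"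
    and countable_below: "countable {\<beta>. \<beta> \<triangleleft> \<alpha>}"
    and almost_subset: "\<beta> \<triangleleft> \<alpha> \<Longrightarrow> finite (T \<beta> - T \<alpha>)"
    and strict: "\<beta> \<triangleleft> \<alpha> \<Longrightarrow> infinite (T \<alpha> - T \<beta>)"
begin

lemma finite_has_greatest:
  assumes "finite F" and "F \<noteq> {}" and "F \<subseteq> {\<gamma>. \<gamma> \<triangleleft> \<beta>}"
  shows "\<exists>\<mu>\<in>F. \<forall>\<gamma>\<in>F. \<gamma> = \<mu> \<or> \<gamma> \<triangleleft> \<mu>"
  using assms
proof (induction F rule: finite_ne_induct)
  case (insert x F)
  then obtain \<mu> where \<mu>: "\<mu> \<in> F" "\<forall>\<gamma>\<in>F. \<gamma> = \<mu> \<or> \<gamma> \<triangleleft> \<mu>" by auto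
  have "\<mu> \<triangleleft> x \<or> \<mu> = x \<or> x \<triangleleft> \<mu>" using less_linear[of \<mu> \<beta> x] insert.prems \<mu>(1) by auto
  then show ?case
  proof (elim disjE)
    assume "\<mu> \<triangleleft> x"
    then have "\<gamma> \<triangleleft> x" if "\<gamma> \<in> F" for \<gamma>
      using \<mu>(2) that less_trans[of \<gamma> \<mu> x] by auto
    then show ?thesis by simp
  qed (use \<mu> in auto)
qed simp

text \<open>
  A finite union of levels is, up to a finite set, the greatest of them, so that avoiding finitely
  many levels is no harder than avoiding one.
\<close>

lemma infinite_minus_finite_Union:
  assumes "finite F" and "F \<noteq> {}" and "F \<subseteq> {\<gamma>. \<gamma> \<triangleleft> \<beta>}"
    and "\<And>\<gamma>. \<gamma> \<triangleleft> \<beta> \<Longrightarrow> infinite (Y - T \<gamma>)"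
  shows "infinite (Y - (\<Union>\<gamma>\<in>F. T \<gamma>))"
proof -
  obtain \<mu> where \<mu>: "\<mu> \<in> F" "\<forall>\<gamma>\<in>F. \<gamma> = \<mu> \<or> \<gamma> \<triangleleft> \<mu>"
    using finite_has_greatest assms(1-3) by meson
  have "finite (T \<gamma> - T \<mu>)" if "\<gamma> \<in> F" for \<gamma>
    using \<mu>(2) that almost_subset[of \<gamma> \<mu>] by auto
  then have "finite (\<Union>\<gamma>\<in>F. T \<gamma> - T \<mu>)" using assms(1) by blast
  moreover have "infinite (Y - T \<mu>)" using assms(3,4) \<mu>(1) by auto
  moreover have "Y - T \<mu> \<subseteq> (Y - (\<Union>\<gamma>\<in>F. T \<gamma>)) \<union> (\<Union>\<gamma>\<in>F. T \<gamma> - T \<mu>)" by auto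
  ultimately show ?thesis by (meson finite_UnI finite_subset)
qed

text \<open>
  What is maintained by the recursion when \<open>v\<close> is chosen as the function at level \<open>\<alpha>\<close>. All functions
  are total, but only the values of the function at level \<open>\<beta>\<close> on \<open>T \<beta>\<close> matter. The first clause is
  coherence; the second is Hausdorff's condition; the third leaves infinitely many points of each
  colour outside all earlier levels, which is where later steps find the witnesses that they need.
\<close>

definition extends_tower :: "('i \<Rightarrow> nat \<Rightarrow> nat) \<Rightarrow> 'i \<Rightarrow> (nat \<Rightarrow> nat) \<Rightarrow> bool"
  where "extends_tower g \<alpha> v \<longleftrightarrow>
    (\<forall>\<beta>. \<beta> \<triangleleft> \<alpha> \<longrightarrow> finite {k \<in> T \<beta>. g \<beta> k \<noteq> v k}) \<and>
    (\<forall>n. finite {\<beta>. \<beta> \<triangleleft> \<alpha> \<and> \<not> entangled (T \<beta>) (g \<beta>) (T \<alpha>) v n}) \<and>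
    (\<forall>\<beta> i. \<beta> \<triangleleft> \<alpha> \<longrightarrow> infinite {k \<in> T \<alpha> - T \<beta>. v k = i})"

text \<open>
  Hausdorff's condition at \<open>\<mu>\<close> is inherited by any \<open>v\<close> that almost agrees with \<open>g \<mu>\<close>: the
  finitely many points of disagreement or outside \<open>T \<alpha>\<close> are discarded by raising the parameter. Hence the indices
  violating the condition at a level \<open>\<alpha>\<close> can only accumulate towards \<open>\<alpha>\<close> itself.
\<close>

lemma finite_not_entangled:
  assumes "\<mu> \<triangleleft> \<alpha>" and "extends_tower g \<mu> (g \<mu>)" and "finite {k \<in> T \<mu>. g \<mu> k \<noteq> v k}"
  shows "finite {\<beta>. (\<beta> = \<mu> \<or> \<beta> \<triangleleft> \<mu>) \<and> \<not> entangled (T \<beta>) (g \<beta>) (T \<alpha>) v n}"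
proof -
  have "finite ((T \<mu> - T \<alpha>) \<union> {k \<in> T \<mu>. g \<mu> k \<noteq> v k})"
    using almost_subset assms(1,3) by auto
  then obtain N0 where N0: "(T \<mu> - T \<alpha>) \<union> {k \<in> T \<mu>. g \<mu> k \<noteq> v k} \<subseteq> {..<N0}"
    using finite_nat_iff_bounded by blast
  define N where "N = max n N0"
  have "entangled (T \<beta>) (g \<beta>) (T \<alpha>) v n" if "entangled (T \<beta>) (g \<beta>) (T \<mu>) (g \<mu>) N" for \<beta>
  proof (rule entangled_weaken[OF that])
    show "n \<le> N" by (simp add: N_def)
    fix k assume k: "N \<le> k" "k \<in> T \<beta> \<inter> T \<mu>" "g \<mu> k = 0"
    then have "k \<notin> {..<N0}" by (simp add: N_def)
    then show "k \<in> T \<alpha> \<and> v k = 0" using N0 k by auto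
  qed
  then have "{\<beta>. (\<beta> = \<mu> \<or> \<beta> \<triangleleft> \<mu>) \<and> \<not> entangled (T \<beta>) (g \<beta>) (T \<alpha>) v n}
      \<subseteq> insert \<mu> {\<beta>. \<beta> \<triangleleft> \<mu> \<and> \<not> entangled (T \<beta>) (g \<beta>) (T \<mu>) (g \<mu>) N}" by auto
  then show ?thesis using assms(2) unfolding extends_tower_def by (meson finite.insertI finite_subset)
qed

text \<open>
  On each level use the function of the first enumerated level that contains the point; on
  \<open>T (\<gamma> l)\<close> only the finitely many functions enumerated up to \<open>l\<close> then occur.
\<close>

lemma countable_amalgamation:
  fixes \<gamma> :: "nat \<Rightarrow> 'i"
  assumes coh: "\<And>l. extends_tower g (\<gamma> l) (g (\<gamma> l))" and below: "\<And>l. \<gamma> l \<triangleleft> \<alpha>"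
  shows "\<exists>v. \<forall>l. finite {k \<in> T (\<gamma> l). g (\<gamma> l) k \<noteq> v k}"
proof -
  define v where "v k = g (\<gamma> (LEAST l. k \<in> T (\<gamma> l))) k" for k
  have pair: "finite {k \<in> T (\<gamma> m) \<inter> T (\<gamma> l). g (\<gamma> l) k \<noteq> g (\<gamma> m) k}" for l m
  proof -
    consider "\<gamma> l \<triangleleft> \<gamma> m" | "\<gamma> l = \<gamma> m" | "\<gamma> m \<triangleleft> \<gamma> l" using less_linear below by blast
    then show ?thesis
    proof cases
      case 1
      then have "finite {k \<in> T (\<gamma> l). g (\<gamma> l) k \<noteq> g (\<gamma> m) k}"
        using coh[of m] unfolding extends_tower_def by blast
      then show ?thesis by (rule rev_finite_subset) auto
    next
      case 3
      then have "finite {k \<in> T (\<gamma> m). g (\<gamma> m) k \<noteq> g (\<gamma> l) k}"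
        using coh[of l] unfolding extends_tower_def by blast
      then show ?thesis by (rule rev_finite_subset) auto
    qed simp
  qed
  have "{k \<in> T (\<gamma> l). g (\<gamma> l) k \<noteq> v k}
      \<subseteq> (\<Union>m\<le>l. {k \<in> T (\<gamma> m) \<inter> T (\<gamma> l). g (\<gamma> l) k \<noteq> g (\<gamma> m) k})" (is "_ \<subseteq> ?U l") for l
  proof
    fix k assume k: "k \<in> {k \<in> T (\<gamma> l). g (\<gamma> l) k \<noteq> v k}"
    define m where "m = (LEAST l. k \<in> T (\<gamma> l))"
    have "m \<le> l" using k Least_le[of "\<lambda>l. k \<in> T (\<gamma> l)" l] by (simp add: m_def)
    moreover have "k \<in> T (\<gamma> m)" unfolding m_def using k LeastI[of "\<lambda>l. k \<in> T (\<gamma> l)" l] by simp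
    moreover have "v k = g (\<gamma> m) k" by (simp add: v_def m_def)
    ultimately show "k \<in> ?U l" using k by auto
  qed
  then have "finite {k \<in> T (\<gamma> l). g (\<gamma> l) k \<noteq> v k}" for l
    using pair by (meson finite_UN finite_atMost finite_subset)
  then show ?thesis by blast
qed

text \<open>
  A diagonal sequence: its range is almost disjoint from each of countably many earlier levels, so
  that a function may be given arbitrary values there without losing coherence.
\<close>

lemma almost_disjoint_sequence:
  fixes \<gamma> :: "nat \<Rightarrow> 'i"
  assumes below: "\<And>l. \<gamma> l \<triangleleft> \<alpha>"
  shows "\<exists>z :: nat \<Rightarrow> nat. strict_mono z \<and> range z \<subseteq> T \<alpha> \<and> (\<forall>l k. l < k \<longrightarrow> z k \<notin> T (\<gamma> l))"
proof -
  define Y where "Y k = T \<alpha> - (\<Union>l<k. T (\<gamma> l))" for k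
  have "infinite (Y (Suc k))" for k
  proof -
    have "infinite (T \<alpha> - (\<Union>\<beta>\<in>\<gamma> ` {..<Suc k}. T \<beta>))"
      using below strict by (intro infinite_minus_finite_Union[where \<beta> = \<alpha>]) auto
    then show ?thesis by (simp add: Y_def)
  qed
  moreover have "Y (Suc k) \<subseteq> Y k" for k by (auto simp: Y_def)
  ultimately have inf: "infinite (Y k)" for k by (meson finite_subset)
  have "\<exists>z. \<forall>k. z k \<in> Y k \<and> z k < z (Suc k)"
  proof (rule dependent_nat_choice)
    show "\<exists>x. x \<in> Y 0" using inf[of 0] by (metis finite.emptyI equals0I)
    show "\<exists>y. y \<in> Y (Suc n) \<and> x < y" for x n
      using inf[of "Suc n"] by (meson infinite_nat_iff_unbounded)
  qed
  then obtain z where z: "\<And>k. z k \<in> Y k" "\<And>k. z k < z (Suc k)" by blast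
  then have "strict_mono z" by (simp add: strict_mono_Suc_iff)
  moreover have "z k \<in> T \<alpha>" and "l < k \<Longrightarrow> z k \<notin> T (\<gamma> l)" for l k
    using z(1)[of k] unfolding Y_def by blast+
  ultimately show ?thesis by blast
qed

text \<open>
  The successor and limit cases are treated together, from an arbitrary enumeration \<open>\<gamma>\<close> of the
  predecessors. The amalgam \<open>g0\<close> of the earlier functions is recoloured to \<open>g1\<close> on a diagonal
  sequence, where every colour is used infinitely often. Then Hausdorff's condition is repaired: each
  index \<open>\<beta>\<close> that violates it at the stage \<open>c \<beta>\<close> where the enumeration first reaches \<open>\<beta>\<close> receives its
  own finite set of new points of colour \<open>0\<close>. These lie outside the levels enumerated before
  stage \<open>c \<beta>\<close>, and only finitely many \<open>\<beta>\<close> of any stage need repair, so the new points meet every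
  level in a finite set.
\<close>

lemma extends_tower_step:
  assumes IH: "\<And>\<beta>. \<beta> \<triangleleft> \<alpha> \<Longrightarrow> extends_tower g \<beta> (g \<beta>)"
  shows "\<exists>v. extends_tower g \<alpha> v"
proof (cases "\<exists>\<beta>. \<beta> \<triangleleft> \<alpha>")
  case False
  then show ?thesis by (simp add: extends_tower_def)
next
  case True
  then have "{\<beta>. \<beta> \<triangleleft> \<alpha>} \<noteq> {}" by auto
  then obtain \<gamma> :: "nat \<Rightarrow> 'i" where \<gamma>: "range \<gamma> = {\<beta>. \<beta> \<triangleleft> \<alpha>}"
    using countable_below range_from_nat_into by metis
  then have below: "\<gamma> l \<triangleleft> \<alpha>" for l by auto
  have surj: "\<exists>l. \<beta> = \<gamma> l" if "\<beta> \<triangleleft> \<alpha>" for \<beta> using \<gamma> that by blast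
  obtain g0 where g0: "\<And>l. finite {k \<in> T (\<gamma> l). g (\<gamma> l) k \<noteq> g0 k}"
    using countable_amalgamation[of g \<gamma> \<alpha>, OF IH[OF below] below] by blast
  obtain z :: "nat \<Rightarrow> nat" where z: "strict_mono z" "range z \<subseteq> T \<alpha>" "\<And>l k. l < k \<Longrightarrow> z k \<notin> T (\<gamma> l)"
    using almost_disjoint_sequence[of \<gamma> \<alpha>, OF below] by blast
  have inj_z: "inj z" using z(1) by (simp add: strict_mono_imp_inj_on)
  have fin_z: "finite (T (\<gamma> l) \<inter> range z)" for l
  proof (rule finite_subset)
    show "T (\<gamma> l) \<inter> range z \<subseteq> z ` {..l}"
    proof
      fix y assume y: "y \<in> T (\<gamma> l) \<inter> range z"
      then obtain k where "y = z k" by auto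
      then show "y \<in> z ` {..l}" using y z(3)[of l k] by (cases "l < k") auto
    qed
  qed simp
  define g1 where "g1 k = (if k \<in> range z then fst (prod_decode (inv_into UNIV z k)) else g0 k)" for k
  have g1: "finite {k \<in> T (\<gamma> l). g (\<gamma> l) k \<noteq> g1 k}" for l
    by (rule finite_subset[OF _ finite_UnI[OF g0[of l] fin_z[of l]]]) (auto simp: g1_def)
  \<comment> \<open>the stage of \<open>\<beta>\<close>: all levels enumerated before it lie strictly below \<open>\<beta>\<close>\<close>
  define c where "c \<beta> = (LEAST l. \<beta> = \<gamma> l \<or> \<beta> \<triangleleft> \<gamma> l)" for \<beta>
  have c: "\<beta> = \<gamma> (c \<beta>) \<or> \<beta> \<triangleleft> \<gamma> (c \<beta>)" if "\<beta> \<triangleleft> \<alpha>" for \<beta>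
  proof -
    obtain s where "\<beta> = \<gamma> s" using surj[OF \<open>\<beta> \<triangleleft> \<alpha>\<close>] by blast
    then show ?thesis using LeastI[of "\<lambda>l. \<beta> = \<gamma> l \<or> \<beta> \<triangleleft> \<gamma> l" s] by (simp add: c_def)
  qed
  have c_less: "\<gamma> l \<triangleleft> \<beta>" if "\<beta> \<triangleleft> \<alpha>" "l < c \<beta>" for \<beta> l
  proof -
    have "\<not> (\<beta> = \<gamma> l \<or> \<beta> \<triangleleft> \<gamma> l)" using that(2) unfolding c_def by (rule not_less_Least)
    then show ?thesis using less_linear that(1) below by blast
  qed
  define bad where "bad \<beta> \<longleftrightarrow> \<beta> \<triangleleft> \<alpha> \<and> \<not> entangled (T \<beta>) (g \<beta>) (T \<alpha>) g1 (c \<beta>)" for \<beta>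
  have finite_bad: "finite {\<beta>. bad \<beta> \<and> c \<beta> \<le> l}" for l
  proof (rule finite_subset)
    show "{\<beta>. bad \<beta> \<and> c \<beta> \<le> l} \<subseteq>
      (\<Union>s\<in>{..l}. {\<beta>. (\<beta> = \<gamma> s \<or> \<beta> \<triangleleft> \<gamma> s) \<and> \<not> entangled (T \<beta>) (g \<beta>) (T \<alpha>) g1 l})"
    proof
      fix \<beta> assume "\<beta> \<in> {\<beta>. bad \<beta> \<and> c \<beta> \<le> l}"
      then have \<beta>: "\<beta> \<triangleleft> \<alpha>" "\<not> entangled (T \<beta>) (g \<beta>) (T \<alpha>) g1 (c \<beta>)" "c \<beta> \<le> l"
        by (simp_all add: bad_def)
      then have "\<not> entangled (T \<beta>) (g \<beta>) (T \<alpha>) g1 l" using entangled_antimono by blast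
      then show "\<beta> \<in> (\<Union>s\<in>{..l}. {\<beta>. (\<beta> = \<gamma> s \<or> \<beta> \<triangleleft> \<gamma> s) \<and>
          \<not> entangled (T \<beta>) (g \<beta>) (T \<alpha>) g1 l})"
        using c[OF \<beta>(1)] \<beta>(3) by (intro UN_I[of "c \<beta>"]) simp_all
    qed
    show "finite \<dots>"
      by (intro finite_UN_I finite_atMost finite_not_entangled[OF below IH[OF below] g1])
  qed
  have "\<exists>k. k \<ge> c \<beta> \<and> k \<in> T \<beta> \<inter> T \<alpha> \<and> k \<notin> range z \<and> (\<forall>l < c \<beta>. k \<notin> T (\<gamma> l)) \<and> g \<beta> k = i"
    if "bad \<beta>" for \<beta> i
  proof -
    have \<beta>: "\<beta> \<triangleleft> \<alpha>" using that by (simp add: bad_def)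
    \<comment> \<open>At stage 0 the condition is vacuous. So some level below \<open>\<beta>\<close> has been enumerated, and
      the points of colour \<open>i\<close> at \<open>\<beta>\<close> outside that level are infinitely many.\<close>
    have "c \<beta> \<noteq> 0" using that by (auto simp: bad_def entangled_def)
    define F where "F = \<gamma> ` {..<c \<beta>}"
    have "infinite ({k \<in> T \<beta>. g \<beta> k = i} - (\<Union>\<delta>\<in>F. T \<delta>))"
    proof (rule infinite_minus_finite_Union)
      show "finite F" "F \<noteq> {}" "F \<subseteq> {\<gamma>. \<gamma> \<triangleleft> \<beta>}"
        using \<open>c \<beta> \<noteq> 0\<close> c_less[OF \<beta>] by (auto simp: F_def)
      show "infinite ({k \<in> T \<beta>. g \<beta> k = i} - T \<delta>)" if "\<delta> \<triangleleft> \<beta>" for \<delta>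
      proof -
        have "{k \<in> T \<beta>. g \<beta> k = i} - T \<delta> = {k \<in> T \<beta> - T \<delta>. g \<beta> k = i}" by auto
        then show ?thesis using IH[OF \<beta>] that unfolding extends_tower_def by metis
      qed
    qed
    moreover have "finite ((T \<beta> - T \<alpha>) \<union> (T \<beta> \<inter> range z) \<union> {..<c \<beta>})"
      using almost_subset[OF \<beta>] fin_z surj[OF \<beta>] by auto
    ultimately have "infinite ({k \<in> T \<beta>. g \<beta> k = i} - (\<Union>\<delta>\<in>F. T \<delta>)
        - ((T \<beta> - T \<alpha>) \<union> (T \<beta> \<inter> range z) \<union> {..<c \<beta>}))" by (rule Diff_infinite_finite[rotated])
    then obtain k where "k \<in> {k \<in> T \<beta>. g \<beta> k = i} - (\<Union>\<delta>\<in>F. T \<delta>)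
        - ((T \<beta> - T \<alpha>) \<union> (T \<beta> \<inter> range z) \<union> {..<c \<beta>})" by (metis finite.emptyI equals0I)
    then show ?thesis by (intro exI[of _ k]) (auto simp: F_def)
  qed
  then obtain q where q: "\<And>\<beta> i. bad \<beta> \<Longrightarrow> q \<beta> i \<ge> c \<beta> \<and> q \<beta> i \<in> T \<beta> \<inter> T \<alpha> \<and> q \<beta> i \<notin> range z \<and>
      (\<forall>l < c \<beta>. q \<beta> i \<notin> T (\<gamma> l)) \<and> g \<beta> (q \<beta> i) = i" by metis
  define Q where "Q = (\<Union>\<beta>\<in>{\<beta>. bad \<beta>}. q \<beta> ` {1..c \<beta>})"
  have fin_Q: "finite (T (\<gamma> l) \<inter> Q)" for l
  proof (rule finite_subset)
    show "T (\<gamma> l) \<inter> Q \<subseteq> (\<Union>\<beta>\<in>{\<beta>. bad \<beta> \<and> c \<beta> \<le> l}. q \<beta> ` {1..c \<beta>})"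
    proof
      fix k assume k: "k \<in> T (\<gamma> l) \<inter> Q"
      then obtain \<beta> i where \<beta>: "bad \<beta>" "i \<in> {1..c \<beta>}" "k = q \<beta> i" by (auto simp: Q_def)
      then have "c \<beta> \<le> l" using q[OF \<beta>(1), of i] k by (meson IntD1 not_less)
      then show "k \<in> (\<Union>\<beta>\<in>{\<beta>. bad \<beta> \<and> c \<beta> \<le> l}. q \<beta> ` {1..c \<beta>})" using \<beta> by blast
    qed
    show "finite \<dots>" using finite_bad by blast
  qed
  define v where "v k = (if k \<in> Q then 0 else g1 k)" for k
  have v: "finite {k \<in> T (\<gamma> l). g (\<gamma> l) k \<noteq> v k}" for l
    by (rule finite_subset[OF _ finite_UnI[OF g1[of l] fin_Q[of l]]]) (auto simp: v_def)
  have "finite {\<beta>. \<beta> \<triangleleft> \<alpha> \<and> \<not> entangled (T \<beta>) (g \<beta>) (T \<alpha>) v n}" for n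
  proof (rule finite_subset)
    show "{\<beta>. \<beta> \<triangleleft> \<alpha> \<and> \<not> entangled (T \<beta>) (g \<beta>) (T \<alpha>) v n} \<subseteq>
      (\<Union>s<n. {\<beta>. (\<beta> = \<gamma> s \<or> \<beta> \<triangleleft> \<gamma> s) \<and> \<not> entangled (T \<beta>) (g \<beta>) (T \<alpha>) v n})"
    proof
      fix \<beta> assume "\<beta> \<in> {\<beta>. \<beta> \<triangleleft> \<alpha> \<and> \<not> entangled (T \<beta>) (g \<beta>) (T \<alpha>) v n}"
      then have \<beta>: "\<beta> \<triangleleft> \<alpha>" "\<not> entangled (T \<beta>) (g \<beta>) (T \<alpha>) v n" by auto
      have "entangled (T \<beta>) (g \<beta>) (T \<alpha>) v (c \<beta>)"
      proof (cases "bad \<beta>")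
        case True
        then show ?thesis using q[OF True] unfolding entangled_def
          by (intro ballI exI[of _ "q \<beta> _"]) (auto simp: v_def Q_def)
      next
        case False
        then have "entangled (T \<beta>) (g \<beta>) (T \<alpha>) g1 (c \<beta>)" using \<beta>(1) by (simp add: bad_def)
        then show ?thesis by (rule entangled_weaken) (auto simp: v_def)
      qed
      \<comment> \<open>after the repair, an index can violate the condition for \<open>n\<close> only if its stage is below \<open>n\<close>\<close>
      then have "c \<beta> < n" using \<beta>(2) entangled_antimono not_less by blast
      then show "\<beta> \<in> (\<Union>s<n. {\<beta>. (\<beta> = \<gamma> s \<or> \<beta> \<triangleleft> \<gamma> s) \<and> \<not> entangled (T \<beta>) (g \<beta>) (T \<alpha>) v n})"
        using c[OF \<beta>(1)] \<beta>(2) by (intro UN_I[of "c \<beta>"]) simp_all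
    qed
    show "finite \<dots>"
      by (intro finite_UN_I finite_lessThan finite_not_entangled[OF below IH[OF below] v])
  qed
  moreover have "infinite {k \<in> T \<alpha> - T \<beta>. v k = i}" if "\<beta> \<triangleleft> \<alpha>" for \<beta> i
  proof -
    obtain l where l: "\<beta> = \<gamma> l" using surj \<open>\<beta> \<triangleleft> \<alpha>\<close> by blast
    \<comment> \<open>the indices at which the diagonal sequence has colour \<open>i\<close>\<close>
    have "infinite (range (\<lambda>m. prod_encode (i, m)))"
      by (rule range_inj_infinite) (simp add: inj_on_def)
    then have "infinite (range (\<lambda>m. prod_encode (i, m)) - {..l})"
      by (simp add: Diff_infinite_finite)
    then have "infinite (z ` (range (\<lambda>m. prod_encode (i, m)) - {..l}))"
      using inj_z by (meson finite_imageD inj_on_subset subset_UNIV)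
    moreover have "z ` (range (\<lambda>m. prod_encode (i, m)) - {..l}) \<subseteq> {k \<in> T \<alpha> - T \<beta>. v k = i}"
    proof -
      have "z k \<notin> Q" for k
      proof
        assume "z k \<in> Q"
        then obtain \<beta> i where "bad \<beta>" "z k = q \<beta> i" by (auto simp: Q_def)
        then show False using q[of \<beta> i] by (metis rangeI)
      qed
      then have "v (z k) = fst (prod_decode k)" for k using inj_z by (simp add: v_def g1_def)
      then show ?thesis using z(2,3) l by auto
    qed
    ultimately show ?thesis by (meson finite_subset)
  qed
  moreover have "finite {k \<in> T \<beta>. g \<beta> k \<noteq> v k}" if "\<beta> \<triangleleft> \<alpha>" for \<beta>
  proof -
    obtain l where "\<beta> = \<gamma> l" using surj \<open>\<beta> \<triangleleft> \<alpha>\<close> by blast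
    then show ?thesis using v by simp
  qed
  ultimately have "extends_tower g \<alpha> v" by (simp add: extends_tower_def)
  then show ?thesis by blast
qed

theorem exists_entangled_family:
  "\<exists>g. \<forall>\<alpha>. extends_tower g \<alpha> (g \<alpha>)"
proof (rule dependent_wf_choice[OF wf_less])
  fix f g :: "'i \<Rightarrow> nat \<Rightarrow> nat" and \<alpha> v
  assume "\<And>\<beta>. (\<beta>, \<alpha>) \<in> {(\<beta>, \<alpha>). \<beta> \<triangleleft> \<alpha>} \<Longrightarrow> f \<beta> = g \<beta>"
  then show "extends_tower f \<alpha> v = extends_tower g \<alpha> v" by (simp add: extends_tower_def cong: conj_cong)
next
  fix \<alpha> and f :: "'i \<Rightarrow> nat \<Rightarrow> nat"
  assume "\<And>\<beta>. (\<beta>, \<alpha>) \<in> {(\<beta>, \<alpha>). \<beta> \<triangleleft> \<alpha>} \<Longrightarrow> extends_tower f \<beta> (f \<beta>)"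
  then show "\<exists>v. extends_tower f \<alpha> v" by (intro extends_tower_step) auto
qed

text \<open>
  Hausdorff's argument. If \<open>A\<close> almost agrees with \<open>h \<circ> g \<alpha>\<close> on every level, then for uncountably many
  \<open>\<alpha>\<close> the disagreement lies below one \<open>n\<close>. Among these, choose \<open>\<alpha>\<close> above infinitely many \<open>\<beta>\<close>. For one
  of them, the entanglement yields a point \<open>k \<ge> n\<close> at which \<open>g \<beta>\<close> is \<open>i\<close> and \<open>g \<alpha>\<close> is \<open>0\<close>,
  so that \<open>A k\<close> must be both \<open>h i\<close> and \<open>h 0\<close>.
\<close>

lemma entangled_family_nontrivial:
  assumes g: "\<And>\<alpha>. extends_tower g \<alpha> (g \<alpha>)"
    and uncountable: "uncountable I"
    and linear: "\<And>\<alpha> \<beta>. \<alpha> \<in> I \<Longrightarrow> \<beta> \<in> I \<Longrightarrow> \<alpha> \<triangleleft> \<beta> \<or> \<alpha> = \<beta> \<or> \<beta> \<triangleleft> \<alpha>"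
    and A: "\<And>\<alpha>. \<alpha> \<in> I \<Longrightarrow> finite {k \<in> T \<alpha>. A k \<noteq> h (g \<alpha> k)}"
  shows "h i = h 0"
proof (rule ccontr)
  assume neq: "h i \<noteq> h 0"
  define J where "J n = {\<alpha> \<in> I. {k \<in> T \<alpha>. A k \<noteq> h (g \<alpha> k)} \<subseteq> {..<n}}" for n
  have "I \<subseteq> (\<Union>n. J n)"
  proof
    fix \<alpha> assume "\<alpha> \<in> I"
    then obtain n where "{k \<in> T \<alpha>. A k \<noteq> h (g \<alpha> k)} \<subseteq> {..<n}"
      using A[of \<alpha>] unfolding finite_nat_iff_bounded by blast
    then have "\<alpha> \<in> J n" using \<open>\<alpha> \<in> I\<close> by (simp add: J_def)
    then show "\<alpha> \<in> (\<Union>n. J n)" by blast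
  qed
  then have "\<not> countable (\<Union>n. J n)" using uncountable countable_subset by blast
  then obtain n where J: "uncountable (J n)" by auto
  then obtain J0 where J0: "J0 \<subseteq> J n" "countable J0" "infinite J0"
    using infinite_countable_subset'[OF uncountable_infinite[OF J]] by blast
  \<comment> \<open>a countable set of indices is bounded by an element of any uncountable one\<close>
  have "countable (J0 \<union> (\<Union>\<beta>\<in>J0. {\<gamma>. \<gamma> \<triangleleft> \<beta>}))" using J0(2) countable_below by simp
  then obtain \<alpha> where \<alpha>: "\<alpha> \<in> J n" "\<alpha> \<notin> J0 \<union> (\<Union>\<beta>\<in>J0. {\<gamma>. \<gamma> \<triangleleft> \<beta>})"
    using J by (meson countable_subset subsetI)
  have below: "\<beta> \<triangleleft> \<alpha>" if "\<beta> \<in> J0" for \<beta>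
  proof -
    have "\<beta> \<in> I" "\<alpha> \<in> I" using that J0(1) \<alpha>(1) by (auto simp: J_def)
    then show ?thesis using linear[of \<beta> \<alpha>] \<alpha>(2) that by auto
  qed
  define N where "N = max n i"
  have "finite {\<beta>. \<beta> \<triangleleft> \<alpha> \<and> \<not> entangled (T \<beta>) (g \<beta>) (T \<alpha>) (g \<alpha>) N}"
    using g[of \<alpha>] unfolding extends_tower_def by blast
  then obtain \<beta> where \<beta>: "\<beta> \<in> J0" "entangled (T \<beta>) (g \<beta>) (T \<alpha>) (g \<alpha>) N"
    using J0(3) below by (metis (mono_tags, lifting) finite_subset mem_Collect_eq subsetI)
  have "i \<in> {1..N}" using neq by (cases i) (auto simp: N_def)
  then obtain k where k: "k \<ge> N" "k \<in> T \<beta> \<inter> T \<alpha>" "g \<beta> k = i" "g \<alpha> k = 0"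
    using \<beta>(2) unfolding entangled_def by blast
  have "A k = h (g \<delta> k)" if "\<delta> \<in> J n" "k \<in> T \<delta>" for \<delta>
    using that k(1) by (fastforce simp: J_def N_def)
  then have "A k = h i" and "A k = h 0" using \<alpha>(1) \<beta>(1) J0(1) k(2-4) by (metis IntD1 IntD2 subsetD)+
  then show False using neq by simp
qed

end

section \<open>Cohomology classes of coherent families\<close>

lemma carrier_finsupp_group:
  "x \<in> carrier (finsupp_group D) \<longleftrightarrow>
    x \<in> extensional D \<and> (\<forall>n\<in>D. x n = 0 \<or> x n = 1) \<and> finite {n \<in> D. x n \<noteq> 0}"
proof -
  have "{0..<int 2} = {0, 1}" by auto
  then show ?thesis
    by (auto simp: finsupp_group_def carrier_sum_group carrier_integer_mod_group PiE_iff)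
qed

lemma mult_finsupp_group: "x \<otimes>\<^bsub>finsupp_group D\<^esub> y = (\<lambda>n\<in>D. (x n + y n) mod 2)"
  by (simp add: finsupp_group_def)

lemma one_finsupp_group: "\<one>\<^bsub>finsupp_group D\<^esub> = (\<lambda>n\<in>D. 0)"
  by (simp add: finsupp_group_def)

lemma comm_group_finsupp_group: "comm_group (finsupp_group D)"
proof -
  interpret group "finsupp_group D" by (simp add: finsupp_group_def)
  show ?thesis by (rule group_comm_groupI) (simp add: mult_finsupp_group add.commute)
qed

text \<open>
  Every element has order at most 2, so the signs in the coboundary formula disappear.
\<close>

lemma pow_sign_finsupp_group:
  assumes x: "x \<in> carrier (finsupp_group D)"
  shows "x [^]\<^bsub>finsupp_group D\<^esub> ((-1) ^ i :: int) = x"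
proof -
  interpret comm_group "finsupp_group D" by (rule comm_group_finsupp_group)
  have "x \<otimes>\<^bsub>finsupp_group D\<^esub> x = \<one>\<^bsub>finsupp_group D\<^esub>"
    using x by (auto simp: carrier_finsupp_group mult_finsupp_group one_finsupp_group)
  then have "inv\<^bsub>finsupp_group D\<^esub> x = x" using x inv_equality by blast
  then show ?thesis using x by (cases "even i") (simp_all add: int_pow_neg)
qed

lemma restrict_finsupp_group:
  assumes "x \<in> carrier (finsupp_group D)" and "E \<subseteq> D"
  shows "restrict x E \<in> carrier (finsupp_group E)"
proof -
  have "finite {n \<in> D. x n \<noteq> 0}" using assms(1) by (simp add: carrier_finsupp_group)
  then have "finite {n \<in> E. restrict x E n \<noteq> 0}"
    by (rule rev_finite_subset) (use assms(2) in auto)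
  then show ?thesis using assms by (auto simp: carrier_finsupp_group)
qed

lemma desc_chains_0: "s \<in> desc_chains \<D> 0 \<longleftrightarrow> (\<exists>D\<in>\<D>. s = [D])"
  by (auto simp: desc_chains_def length_Suc_conv)

lemma desc_chains_1: "s \<in> desc_chains \<D> 1 \<longleftrightarrow> (\<exists>D\<in>\<D>. \<exists>E\<in>\<D>. E \<subseteq> D \<and> s = [D, E])"
  by (auto simp: desc_chains_def length_Suc_conv)

lemma desc_chains_2:
  "s \<in> desc_chains \<D> 2 \<longleftrightarrow> (\<exists>D\<in>\<D>. \<exists>E\<in>\<D>. \<exists>F\<in>\<D>. E \<subseteq> D \<and> F \<subseteq> E \<and> s = [D, E, F])"
  by (auto simp: desc_chains_def length_Suc_conv numeral_2_eq_2)

lemma cochains_value: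
  assumes "x \<in> carrier (cochains \<D> n)" and "s \<in> desc_chains \<D> n"
  shows "x s \<in> carrier (finsupp_group (last s))"
  using assms by (auto simp: cochains_def PiE_iff)

lemma coboundary_0:
  assumes y: "y \<in> carrier (cochains \<D> 0)" and "D \<in> \<D>" "E \<in> \<D>" "E \<subseteq> D"
  shows "coboundary \<D> 0 y [D, E] = (\<lambda>n\<in>E. (y [E] n + y [D] n) mod 2)"
proof -
  interpret comm_group "finsupp_group E" by (rule comm_group_finsupp_group)
  have yE: "y [E] \<in> carrier (finsupp_group E)" and "y [D] \<in> carrier (finsupp_group D)"
    using cochains_value[OF y, of "[E]"] cochains_value[OF y, of "[D]"] assms
    by (simp_all add: desc_chains_0)
  then have yD: "restrict (y [D]) E \<in> carrier (finsupp_group E)"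
    using assms restrict_finsupp_group by blast
  have "[D, E] \<in> desc_chains \<D> (Suc 0)" using assms desc_chains_1[of "[D, E]" \<D>] by auto
  then have "coboundary \<D> 0 y [D, E] = y [E] \<otimes>\<^bsub>finsupp_group E\<^esub> restrict (y [D]) E"
    using yE pow_sign_finsupp_group[OF yE, of 0] pow_sign_finsupp_group[OF yD, of 1]
    by (simp add: coboundary_def omit_def)
  then show ?thesis by (auto simp: mult_finsupp_group)
qed

lemma coboundary_1:
  assumes x: "x \<in> carrier (cochains \<D> 1)" and "D \<in> \<D>" "E \<in> \<D>" "F \<in> \<D>" "E \<subseteq> D" "F \<subseteq> E"
  shows "coboundary \<D> 1 x [D, E, F] = (\<lambda>n\<in>F. (x [E, F] n + x [D, F] n + x [D, E] n) mod 2)"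
proof -
  interpret comm_group "finsupp_group F" by (rule comm_group_finsupp_group)
  have chains: "[E, F] \<in> desc_chains \<D> 1" "[D, F] \<in> desc_chains \<D> 1" "[D, E] \<in> desc_chains \<D> 1"
    using assms by (auto simp: desc_chains_1 simp del: One_nat_def)
  have xEF: "x [E, F] \<in> carrier (finsupp_group F)" and xDF: "x [D, F] \<in> carrier (finsupp_group F)"
    and "x [D, E] \<in> carrier (finsupp_group E)"
    using chains[THEN cochains_value[OF x]] by simp_all
  then have xDE: "restrict (x [D, E]) F \<in> carrier (finsupp_group F)"
    using assms restrict_finsupp_group by blast
  have "[D, E, F] \<in> desc_chains \<D> (Suc 1)"
    using assms desc_chains_2[of "[D, E, F]" \<D>] by (auto simp: numeral_2_eq_2)
  moreover have "{0..1::nat} = insert 0 {1}" by auto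
  ultimately have "coboundary \<D> 1 x [D, E, F] = (x [E, F] \<otimes>\<^bsub>finsupp_group F\<^esub> x [D, F])
      \<otimes>\<^bsub>finsupp_group F\<^esub> restrict (x [D, E]) F"
    using xEF xDF pow_sign_finsupp_group[OF xEF, of 0] pow_sign_finsupp_group[OF xDF, of 1]
      pow_sign_finsupp_group[OF xDE, of 2]
    by (simp add: coboundary_def omit_def)
  then show ?thesis by (auto simp: mult_finsupp_group mod_simps)
qed

text \<open>
  The cocycle measuring how far a family of subsets of the members of \<open>\<D>\<close> is from being the family
  of traces of one set. It is the coboundary of \<open>a\<close>, whose members need not be finitely supported;
  coherence makes the coboundary itself finitely supported.
\<close>

definition transition :: "nat set set \<Rightarrow> (nat set \<Rightarrow> nat \<Rightarrow> bool) \<Rightarrow> nat set list \<Rightarrow> nat \<Rightarrow> int"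
  where "transition \<D> a = (\<lambda>s\<in>desc_chains \<D> 1. \<lambda>n\<in>last s. of_bool (a (hd s) n \<noteq> a (last s) n))"

lemma transition_apply:
  assumes "D \<in> \<D>" "E \<in> \<D>" "E \<subseteq> D"
  shows "transition \<D> a [D, E] = (\<lambda>n\<in>E. of_bool (a D n \<noteq> a E n))"
  using assms desc_chains_1[of "[D, E]" \<D>] by (auto simp: transition_def)

definition coherent_on :: "nat set set \<Rightarrow> (nat set \<Rightarrow> nat \<Rightarrow> bool) \<Rightarrow> bool"
  where "coherent_on \<D> a \<longleftrightarrow> (\<forall>D\<in>\<D>. \<forall>E\<in>\<D>. E \<subseteq> D \<longrightarrow> finite {n \<in> E. a D n \<noteq> a E n})"

lemma transition_in_cocycles:
  assumes "coherent_on \<D> a"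
  shows "transition \<D> a \<in> cocycles \<D> 1"
proof -
  have C: "transition \<D> a \<in> carrier (cochains \<D> 1)"
    unfolding cochains_def carrier_product_group
  proof (rule PiE_I)
    fix s assume "s \<in> desc_chains \<D> 1"
    then obtain D E where s: "D \<in> \<D>" "E \<in> \<D>" "E \<subseteq> D" "s = [D, E]"
      by (auto simp: desc_chains_1 simp del: One_nat_def)
    have "finite {n \<in> E. a D n \<noteq> a E n}" using assms s(1-3) by (auto simp: coherent_on_def)
    then show "transition \<D> a s \<in> carrier (finsupp_group (last s))"
      using s(4) transition_apply[OF s(1-3)]
      by (auto simp: carrier_finsupp_group conj_commute cong: rev_conj_cong elim: rev_finite_subset)
  qed (simp add: transition_def)
  have "coboundary \<D> 1 (transition \<D> a) = \<one>\<^bsub>cochains \<D> (Suc 1)\<^esub>"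
  proof
    fix s
    show "coboundary \<D> 1 (transition \<D> a) s = \<one>\<^bsub>cochains \<D> (Suc 1)\<^esub> s"
    proof (cases "s \<in> desc_chains \<D> (Suc 1)")
      case True
      then obtain D E F where s: "D \<in> \<D>" "E \<in> \<D>" "F \<in> \<D>" "E \<subseteq> D" "F \<subseteq> E" "s = [D, E, F]"
        by (metis Suc_1 desc_chains_2)
      have "coboundary \<D> 1 (transition \<D> a) s = (\<lambda>n\<in>F. 0)"
        unfolding s(6) coboundary_1[OF C s(1-5)] using s(1-5)
        by (auto simp: transition_apply restrict_def fun_eq_iff)
      then show ?thesis using True s(6) by (simp add: cochains_def one_finsupp_group)
    qed (simp add: coboundary_def cochains_def)
  qed
  then show ?thesis using C by (simp add: cocycles_def kernel_def)
qed

definition cohomology_class :: "nat set set \<Rightarrow> (nat set \<Rightarrow> nat \<Rightarrow> bool) \<Rightarrow> (nat set list \<Rightarrow> nat \<Rightarrow> int) set"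
  where "cohomology_class \<D> a =
    coboundaries \<D> 1 #>\<^bsub>(cochains \<D> 1)\<lparr>carrier := cocycles \<D> 1\<rparr>\<^esub> transition \<D> a"

lemma cohomology_class_in_carrier:
  assumes "coherent_on \<D> a"
  shows "cohomology_class \<D> a \<in> carrier (cohomology_group \<D> 1)"
  using transition_in_cocycles[OF assms]
  unfolding cohomology_class_def cohomology_group_def FactGroup_def RCOSETS_def by auto

text \<open>
  The coset unfolded down to the coefficient groups. Equality of classes is used through the
  membership of one transition cocycle in the class of another.
\<close>

lemma cohomology_class_iff:
  "x \<in> cohomology_class \<D> a \<longleftrightarrow> (\<exists>y\<in>carrier (cochains \<D> 0).
    x = (\<lambda>s\<in>desc_chains \<D> 1. coboundary \<D> 0 y s \<otimes>\<^bsub>finsupp_group (last s)\<^esub> transition \<D> a s))"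
  by (auto simp: cohomology_class_def r_coset_def coboundaries_def cochains_def)

lemma transition_in_cohomology_class: "transition \<D> a \<in> cohomology_class \<D> a"
proof -
  define y :: "nat set list \<Rightarrow> nat \<Rightarrow> int" where "y = (\<lambda>s\<in>desc_chains \<D> 0. \<lambda>n\<in>last s. 0)"
  have y: "y \<in> carrier (cochains \<D> 0)"
    by (auto simp: y_def cochains_def PiE_iff carrier_finsupp_group conj_commute cong: rev_conj_cong)
  have "transition \<D> a s = coboundary \<D> 0 y s \<otimes>\<^bsub>finsupp_group (last s)\<^esub> transition \<D> a s"
    if chain: "s \<in> desc_chains \<D> 1" for s
  proof -
    obtain D E where s: "D \<in> \<D>" "E \<in> \<D>" "E \<subseteq> D" "s = [D, E]"
      using chain by (auto simp: desc_chains_1 simp del: One_nat_def)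
    then show ?thesis
      unfolding s(4) coboundary_0[OF y s(1-3)] transition_apply[OF s(1-3)]
      by (auto simp: mult_finsupp_group y_def desc_chains_0 fun_eq_iff)
  qed
  then have "transition \<D> a =
    (\<lambda>s\<in>desc_chains \<D> 1. coboundary \<D> 0 y s \<otimes>\<^bsub>finsupp_group (last s)\<^esub> transition \<D> a s)"
    by (auto simp: transition_def fun_eq_iff)
  then show ?thesis using y by (auto simp: cohomology_class_iff)
qed

text \<open>
  If two classes agree, the transition cocycles of \<open>a\<close> and \<open>b\<close> differ by the coboundary of a finitely
  supported \<open>y\<close>. Then the modulo 2 sum \<open>u\<close> of \<open>a\<close>, \<open>b\<close> and \<open>y\<close> is compatible with all restrictions.
  Directedness glues it to a single set \<open>A\<close>, which differs from the sum of \<open>a\<close> and \<open>b\<close> on \<open>D\<close> only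
  where \<open>y\<close> is nonzero.
\<close>

theorem cohomology_class_eqD:
  assumes directed: "\<And>D E. D \<in> \<D> \<Longrightarrow> E \<in> \<D> \<Longrightarrow> \<exists>F\<in>\<D>. D \<subseteq> F \<and> E \<subseteq> F"
    and eq: "cohomology_class \<D> a = cohomology_class \<D> b"
  shows "\<exists>A. \<forall>D\<in>\<D>. finite {n \<in> D. A n \<noteq> (a D n \<noteq> b D n)}"
proof -
  have "transition \<D> a \<in> cohomology_class \<D> b" using transition_in_cohomology_class eq by blast
  then obtain y where y: "y \<in> carrier (cochains \<D> 0)" and
    y_eq: "transition \<D> a =
      (\<lambda>s\<in>desc_chains \<D> 1. coboundary \<D> 0 y s \<otimes>\<^bsub>finsupp_group (last s)\<^esub> transition \<D> b s)"
    by (auto simp: cohomology_class_iff)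
  have y_val: "y [D] \<in> carrier (finsupp_group D)" if "D \<in> \<D>" for D
    using cochains_value[OF y, of "[D]"] that by (simp add: desc_chains_0)
  have parity: "((p \<noteq> r) \<noteq> (t = 1)) = ((q \<noteq> w) \<noteq> (s = 1))"
    if "of_bool (p \<noteq> q) = ((s + t) mod 2 + of_bool (r \<noteq> w)) mod (2 :: int)"
      and "s = 0 \<or> s = 1" "t = 0 \<or> t = 1" for p q r w :: bool and s t :: int
    by (cases p; cases q; cases r; cases w) (use that in auto)
  define u where "u D n \<longleftrightarrow> ((a D n \<noteq> b D n) \<noteq> (y [D] n = 1))" for D n
  have u_mono: "u D n = u E n" if DE: "D \<in> \<D>" "E \<in> \<D>" "E \<subseteq> D" and "n \<in> E" for D E n
  proof -
    have "[D, E] \<in> desc_chains \<D> 1" using DE by (auto simp: desc_chains_1 simp del: One_nat_def)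
    then have "transition \<D> a [D, E] n =
        (coboundary \<D> 0 y [D, E] \<otimes>\<^bsub>finsupp_group E\<^esub> transition \<D> b [D, E]) n"
      using fun_cong[OF y_eq, of "[D, E]"] by simp
    then have "of_bool (a D n \<noteq> a E n) =
        ((y [E] n + y [D] n) mod 2 + of_bool (b D n \<noteq> b E n)) mod 2"
      using \<open>n \<in> E\<close>
      by (simp add: transition_apply[OF DE] coboundary_0[OF y DE] mult_finsupp_group)
    moreover have "y [E] n = 0 \<or> y [E] n = 1" "y [D] n = 0 \<or> y [D] n = 1"
      using y_val DE \<open>n \<in> E\<close> by (auto simp: carrier_finsupp_group)
    ultimately show ?thesis unfolding u_def by (rule parity)
  qed
  define A where "A n \<longleftrightarrow> (\<exists>D\<in>\<D>. n \<in> D \<and> u D n)" for n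
  have A: "A n = u D n" if "D \<in> \<D>" "n \<in> D" for D n
  proof -
    have "u E n = u D n" if E: "E \<in> \<D>" "n \<in> E" for E
    proof -
      obtain F where "F \<in> \<D>" "D \<subseteq> F" "E \<subseteq> F" using directed \<open>D \<in> \<D>\<close> \<open>E \<in> \<D>\<close> by blast
      then show ?thesis using u_mono[of F D n] u_mono[of F E n] E \<open>D \<in> \<D>\<close> \<open>n \<in> D\<close> by simp
    qed
    then show ?thesis using that unfolding A_def by blast
  qed
  have "finite {n \<in> D. A n \<noteq> (a D n \<noteq> b D n)}" if "D \<in> \<D>" for D
  proof (rule finite_subset)
    show "{n \<in> D. A n \<noteq> (a D n \<noteq> b D n)} \<subseteq> {n \<in> D. y [D] n \<noteq> 0}"
      using A[OF that] by (auto simp: u_def)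
    show "finite {n \<in> D. y [D] n \<noteq> 0}" using y_val[OF that] by (simp add: carrier_finsupp_group)
  qed
  then show ?thesis by blast
qed

section \<open>The first uncountable ordinal as index order\<close>

definition omega1_less :: "nat set \<Rightarrow> nat set \<Rightarrow> bool"
  where "omega1_less \<beta> \<alpha> \<longleftrightarrow> (\<beta>, \<alpha>) \<in> omega1 \<and> \<beta> \<noteq> \<alpha>"

lemma Card_order_omega1: "Card_order omega1"
  unfolding omega1_def by (rule cardSuc_Card_order[OF natLeq_Card_order])

lemma Well_order_omega1: "Well_order omega1"
  using Card_order_omega1 card_order_on_well_order_on by blast

lemma countable_iff_ordLeq_natLeq: "countable A \<longleftrightarrow> |A| \<le>o natLeq"
proof -
  have "countable A \<longleftrightarrow> |A| \<le>o |UNIV :: nat set|"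
    unfolding countable_def card_of_ordLeq[symmetric] by auto
  then show ?thesis using card_of_nat ordLeq_ordIso_trans ordIso_symmetric by blast
qed

lemma countable_iff_ordLess_omega1: "countable A \<longleftrightarrow> |A| <o omega1"
  unfolding countable_iff_ordLeq_natLeq omega1_def
  using cardSuc_ordLeq_ordLess[OF natLeq_Card_order card_of_Card_order] by blast

lemma omega1_less_linear:
  "\<alpha> \<in> Field omega1 \<Longrightarrow> \<beta> \<in> Field omega1 \<Longrightarrow> omega1_less \<alpha> \<beta> \<or> \<alpha> = \<beta> \<or> omega1_less \<beta> \<alpha>"
  using Well_order_omega1
  unfolding omega1_less_def well_order_on_def linear_order_on_def total_on_def by blast

lemma omega1_less_Field: "omega1_less \<beta> \<alpha> \<Longrightarrow> \<beta> \<in> Field omega1 \<and> \<alpha> \<in> Field omega1"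
  by (auto simp: omega1_less_def Field_def)

lemma uncountable_omega1: "uncountable (Field omega1)"
  using card_of_Field_ordIso[OF Card_order_omega1] not_ordLess_ordIso
  unfolding countable_iff_ordLess_omega1 by blast

lemma strict_tower_omega1:
  assumes "strictly_increasing_tower T"
  shows "strict_tower omega1_less T"
proof
  have antisym: "antisym omega1" and trans: "trans omega1" and wf: "wf (omega1 - Id)"
    using Well_order_omega1
    unfolding well_order_on_def linear_order_on_def partial_order_on_def preorder_on_def by auto
  have "{(\<beta>, \<alpha>). omega1_less \<beta> \<alpha>} = omega1 - Id" by (auto simp: omega1_less_def)
  then show "wf {(\<beta>, \<alpha>). omega1_less \<beta> \<alpha>}" using wf by simp
  fix \<alpha> \<beta> \<gamma>
  show "omega1_less \<gamma> \<beta> \<Longrightarrow> omega1_less \<beta> \<alpha> \<Longrightarrow> omega1_less \<gamma> \<alpha>"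
    using antisym trans unfolding omega1_less_def by (meson antisymD transD)
  show "omega1_less \<beta> \<alpha> \<Longrightarrow> omega1_less \<gamma> \<alpha> \<Longrightarrow> omega1_less \<beta> \<gamma> \<or> \<beta> = \<gamma> \<or> omega1_less \<gamma> \<beta>"
    using omega1_less_linear omega1_less_Field by blast
  show "omega1_less \<beta> \<alpha> \<Longrightarrow> finite (T \<beta> - T \<alpha>)" and "omega1_less \<beta> \<alpha> \<Longrightarrow> infinite (T \<alpha> - T \<beta>)"
    using assms unfolding strictly_increasing_tower_def tower_def omega1_less_def by auto
  show "countable {\<beta>. omega1_less \<beta> \<alpha>}"
  proof (cases "\<alpha> \<in> Field omega1")
    case True
    have "{\<beta>. omega1_less \<beta> \<alpha>} = underS omega1 \<alpha>" by (auto simp: omega1_less_def underS_def)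
    then show ?thesis
      using card_of_underS[OF Card_order_omega1 True] by (simp add: countable_iff_ordLess_omega1)
  next
    case False
    then have "{\<beta>. omega1_less \<beta> \<alpha>} = {}" using omega1_less_Field by blast
    then show ?thesis by simp
  qed
qed

section \<open>The family of sets of a tower\<close>

lemma tower_family_directed:
  assumes T: "strictly_increasing_tower T" and "D \<in> tower_family T" "E \<in> tower_family T"
  shows "\<exists>F\<in>tower_family T. D \<subseteq> F \<and> E \<subseteq> F"
proof -
  interpret strict_tower omega1_less T using T by (rule strict_tower_omega1)
  have main: "D \<union> E \<in> tower_family T"
    if "T \<alpha> \<subseteq> D" "finite (D - T \<alpha>)" "T \<beta> \<subseteq> E" "finite (E - T \<beta>)" "\<alpha> \<in> Field omega1"
      "omega1_less \<beta> \<alpha> \<or> \<beta> = \<alpha>" for \<alpha> \<beta> D E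
  proof -
    have "finite (T \<beta> - T \<alpha>)" using almost_subset that(6) by auto
    then have "finite ((D - T \<alpha>) \<union> (E - T \<beta>) \<union> (T \<beta> - T \<alpha>))" using that by simp
    then have "finite (D \<union> E - T \<alpha>)" by (rule rev_finite_subset) auto
    then show ?thesis using that by (auto simp: tower_family_def)
  qed
  obtain \<alpha> \<beta> where "\<alpha> \<in> Field omega1" "T \<alpha> \<subseteq> D" "finite (D - T \<alpha>)"
    "\<beta> \<in> Field omega1" "T \<beta> \<subseteq> E" "finite (E - T \<beta>)"
    using assms(2,3) by (auto simp: tower_family_def)
  then have "D \<union> E \<in> tower_family T"
    using main[of \<alpha> D \<beta> E] main[of \<beta> E \<alpha> D] omega1_less_linear[of \<alpha> \<beta>] by (auto simp: Un_commute)
  then show ?thesis by blast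
qed

definition level :: "(nat set \<Rightarrow> nat set) \<Rightarrow> nat set \<Rightarrow> nat set"
  where "level T D = (SOME \<alpha>. \<alpha> \<in> Field omega1 \<and> T \<alpha> \<subseteq> D \<and> finite (D - T \<alpha>))"

lemma level:
  assumes "D \<in> tower_family T"
  shows "level T D \<in> Field omega1" "T (level T D) \<subseteq> D" "finite (D - T (level T D))"
proof -
  have "\<exists>\<alpha>. \<alpha> \<in> Field omega1 \<and> T \<alpha> \<subseteq> D \<and> finite (D - T \<alpha>)"
    using assms by (auto simp: tower_family_def)
  from someI_ex[OF this]
  show "level T D \<in> Field omega1" "T (level T D) \<subseteq> D" "finite (D - T (level T D))"
    unfolding level_def by auto
qed

text \<open>
  If \<open>E\<close> had the greater level, \<open>T (level T E)\<close> would lie in \<open>E \<subseteq> D\<close> and hence be almost contained in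
  \<open>T (level T D)\<close>, against strictness. So two members of a chain of the family are compared by the
  coherence at the level of the larger one.
\<close>

lemma level_mono:
  assumes T: "strictly_increasing_tower T"
    and D: "D \<in> tower_family T" and E: "E \<in> tower_family T" and sub: "E \<subseteq> D"
  shows "omega1_less (level T E) (level T D) \<or> level T E = level T D"
proof -
  interpret strict_tower omega1_less T using T by (rule strict_tower_omega1)
  have "T (level T E) - T (level T D) \<subseteq> D - T (level T D)" using level(2)[OF E] sub by auto
  then have "finite (T (level T E) - T (level T D))" using level(3)[OF D] finite_subset by blast
  then have "\<not> omega1_less (level T D) (level T E)" using strict by blast
  then show ?thesis using omega1_less_linear level(1)[OF D] level(1)[OF E] by blast
qed

lemma tower_member:
  assumes T: "strictly_increasing_tower T" and \<alpha>: "\<alpha> \<in> Field omega1"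
  shows "T \<alpha> \<in> tower_family T" "level T (T \<alpha>) = \<alpha>"
proof -
  interpret strict_tower omega1_less T using T by (rule strict_tower_omega1)
  show mem: "T \<alpha> \<in> tower_family T" using \<alpha> by (auto simp: tower_family_def)
  have "T (level T (T \<alpha>)) - T \<alpha> = {}" using level(2)[OF mem] by auto
  then have "\<not> omega1_less \<alpha> (level T (T \<alpha>))" using strict by (metis finite.emptyI)
  moreover have "\<not> omega1_less (level T (T \<alpha>)) \<alpha>" using strict level(3)[OF mem] by blast
  ultimately show "level T (T \<alpha>) = \<alpha>" using omega1_less_linear \<alpha> level(1)[OF mem] by blast
qed

section \<open>Continuum many classes\<close>

theorem corollary18:
  fixes T :: "nat set \<Rightarrow> nat set"
  assumes "strictly_increasing_tower T"
  shows "ctwo ^c natLeq \<le>o |carrier (gap_cohomology_group T)|"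
proof -
  interpret strict_tower omega1_less T using assms by (rule strict_tower_omega1)
  obtain g where g: "\<And>\<alpha>. extends_tower g \<alpha> (g \<alpha>)" using exists_entangled_family by blast
  \<comment> \<open>The colour \<open>0\<close> is kept out of every set of colours, as the entanglement separates only \<open>0\<close>
    from the other colours.\<close>
  define a where "a S D k \<longleftrightarrow> g (level T D) k \<in> Suc ` S" for S D k
  have coherent: "coherent_on (tower_family T) (a S)" for S
    unfolding coherent_on_def
  proof (intro ballI impI)
    fix D E assume D: "D \<in> tower_family T" and E: "E \<in> tower_family T" and "E \<subseteq> D"
    then consider "omega1_less (level T E) (level T D)" | "level T E = level T D"
      using level_mono[OF assms] by blast
    then have "finite {k \<in> T (level T E). g (level T E) k \<noteq> g (level T D) k}"
      by cases (use g[of "level T D"] in \<open>auto simp: extends_tower_def\<close>)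
    then have "finite ({k \<in> T (level T E). g (level T E) k \<noteq> g (level T D) k} \<union> (E - T (level T E)))"
      using level(3)[OF E] by simp
    then show "finite {n \<in> E. a S D n \<noteq> a S E n}"
      by (rule rev_finite_subset) (auto simp: a_def)
  qed
  define cls where "cls S = cohomology_class (tower_family T) (a S)" for S
  have "inj cls"
  proof (rule injI)
    fix R S assume "cls R = cls S"
    then obtain A where A: "\<And>D. D \<in> tower_family T \<Longrightarrow> finite {n \<in> D. A n \<noteq> (a R D n \<noteq> a S D n)}"
      using cohomology_class_eqD[of "tower_family T" "a R" "a S", OF tower_family_directed[OF assms]]
      unfolding cls_def by blast
    define h where "h i \<longleftrightarrow> (i \<in> Suc ` R) \<noteq> (i \<in> Suc ` S)" for i
    have "finite {k \<in> T \<alpha>. A k \<noteq> h (g \<alpha> k)}" if "\<alpha> \<in> Field omega1" for \<alpha>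
      using A[OF tower_member(1)[OF assms that]] tower_member(2)[OF assms that]
      by (simp add: a_def h_def)
    then have "h i = h 0" for i
      using entangled_family_nontrivial[of g "Field omega1" A h i, OF g uncountable_omega1 omega1_less_linear]
      by simp
    then have "h (Suc i) = h 0" for i by blast
    then have "i \<in> R \<longleftrightarrow> i \<in> S" for i by (simp add: h_def image_iff)
    then show "R = S" by blast
  qed
  moreover have "cls S \<in> carrier (gap_cohomology_group T)" for S
    unfolding cls_def gap_cohomology_group_def by (rule cohomology_class_in_carrier[OF coherent])
  ultimately have "|UNIV :: nat set set| \<le>o |carrier (gap_cohomology_group T)|"
    by (intro card_of_ordLeqI) auto
  moreover have "ctwo ^c natLeq =o |UNIV :: nat set set|"
    using card_of_Pow_Func[of "UNIV :: nat set"] ordIso_symmetric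
    by (simp add: ctwo_def cexp_def Field_natLeq)
  ultimately show ?thesis by (rule ordIso_ordLeq_trans[rotated])
qed

end
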